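(* Let $n \geq 1$ and let $K$ be any field. Then a linear map $T\colon M_n(K) \to M_n(K)$ preserving $\mathcal{J}$ is either the zero map or a bijection.
   Context: $M_n(K)$ is the set of $n \times n$ matrices over $K$, viewed as a $K$-vector space and as a monoid under multiplication. Green's relation $\mathcal{J}$ on $M_n(K)$: $A \leq_{\mathcal{J}} B$ if $A = XBY$ for some $X, Y \in M_n(K)$, and $A\,\mathcal{J}\,B$ if $A \leq_{\mathcal{J}} B$ and $B \leq_{\mathcal{J}} A$ (over a field this means that $A$ and $B$ have the same rank). $T$ preserves $\mathcal{J}$ if $A\,\mathcal{J}\,B$ implies $T(A)\,\mathcal{J}\,T(B)$ for all $A,B \in M_n(K)$. *)

theory Defs
  imports "HOL-Analysis.Analysis"
begin

text \<open>
  \<open>M\<^sub>n(K)\<close> is the type \<^typ>\<open>'a::field^'n^'n\<close> with \<open>n = CARD('n)\<close>, which is at least \<open>1\<close> because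
  index types are nonempty. The library operation \<open>(*s)\<close> scales a matrix by a vector of
  scalars, so the scalar multiplication of \<open>M\<^sub>n(K)\<close> over a general field is defined here.
\<close>

definition mat_scale :: "'a::field \<Rightarrow> 'a^'n^'m \<Rightarrow> 'a^'n^'m" where
  "mat_scale c A = map_matrix ((*) c) A"

lemma mat_scale_nth [simp]: "mat_scale c A $ i $ j = c * A $ i $ j"
  by (simp add: mat_scale_def)

lemma vector_space_mat_scale: "vector_space (mat_scale :: 'a::field \<Rightarrow> 'a^'n^'m \<Rightarrow> 'a^'n^'m)"
  by unfold_locales (simp_all add: vec_eq_iff algebra_simps)

definition green_J_le :: "'a::field^'n^'n \<Rightarrow> 'a^'n^'n \<Rightarrow> bool" where
  "green_J_le A B \<longleftrightarrow> (\<exists>X Y. A = X ** B ** Y)"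

definition green_J :: "'a::field^'n^'n \<Rightarrow> 'a^'n^'n \<Rightarrow> bool" where
  "green_J A B \<longleftrightarrow> green_J_le A B \<and> green_J_le B A"

definition preserves_green_J :: "('a::field^'n^'n \<Rightarrow> 'a^'n^'n) \<Rightarrow> bool" where
  "preserves_green_J T \<longleftrightarrow> (\<forall>A B. green_J A B \<longrightarrow> green_J (T A) (T B))"

end

theory Submission
  imports Defs
begin

text \<open>
  The kernel of \<open>T\<close> is a subspace that is a union of \<open>\<J>\<close>-classes, so it is stable under
  multiplication by the invertible matrices \<open>1 + E\<^sub>i\<^sub>j\<close> with \<open>i \<noteq> j\<close>, on either side. Subtracting,
  it is stable under multiplication by \<open>E\<^sub>i\<^sub>j\<close>, and then by \<open>E\<^sub>i\<^sub>i = E\<^sub>i\<^sub>k E\<^sub>k\<^sub>i\<close>; it is thus a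
  two-sided ideal of the simple ring \<open>M\<^sub>n(K)\<close>.
\<close>

definition mat_unit :: "'n \<Rightarrow> 'm \<Rightarrow> 'a::zero_neq_one^'m^'n" where
  "mat_unit i j = (\<chi> r s. if r = i \<and> s = j then 1 else 0)"

lemma mat_unit_nth [simp]: "mat_unit i j $ r $ s = (if r = i \<and> s = j then 1 else 0)"
  by (simp add: mat_unit_def)

lemma mat_unit_mult_nth:
  "(mat_unit i j ** (A :: 'a::semiring_1^'k^'m)) $ r $ s = (if r = i then A $ j $ s else 0)"
  by (simp add: matrix_matrix_mult_def if_distrib[of "\<lambda>x. x * _"] cong: if_cong)

lemma mult_mat_unit_nth:
  "((A :: 'a::semiring_1^'m^'k) ** mat_unit i j) $ r $ s = (if s = j then A $ r $ i else 0)"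
  by (simp add: matrix_matrix_mult_def if_distrib[of "\<lambda>x. _ * x"] cong: if_cong)

lemma mat_unit_mult_mat_unit:
  "mat_unit i j ** mat_unit k l = (if j = k then mat_unit i l else (0 :: 'a::semiring_1^'q^'p))"
  by (simp add: vec_eq_iff mat_unit_mult_nth)

lemma matrix_mult_add_distrib_right:
  "((A :: 'a::semiring_1^'n^'m) + B) ** C = A ** C + B ** C"
  by (simp add: vec_eq_iff matrix_matrix_mult_def distrib_right sum.distrib)

lemma matrix_mult_diff_distrib_right:
  "((A :: 'a::ring_1^'n^'m) - B) ** C = A ** C - B ** C"
  by (simp add: vec_eq_iff matrix_matrix_mult_def left_diff_distrib sum_subtractf)

lemma matrix_mult_diff_distrib_left:
  "(A :: 'a::ring_1^'n^'m) ** (B - C) = A ** B - A ** C"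
  by (simp add: vec_eq_iff matrix_matrix_mult_def right_diff_distrib sum_subtractf)

text \<open>Both products expand to \<open>mat 1 - E ** E\<close>. For
  \<open>E = mat_unit i j\<close> with \<open>i \<noteq> j\<close> this gives explicit inverses of
  transvections, over any field.\<close>

lemma mat_1_minus_mult_mat_1_plus:
  fixes E :: "'a::ring_1^'n^'n"
  assumes "E ** E = 0"
  shows "(mat 1 - E) ** (mat 1 + E) = mat 1" "(mat 1 + E) ** (mat 1 - E) = mat 1"
  using assms by (simp_all add: matrix_add_ldistrib matrix_mult_add_distrib_right
      matrix_mult_diff_distrib_left matrix_mult_diff_distrib_right)

text \<open>A left inverse recovers \<open>A\<close> as \<open>P' ** (P ** A)\<close>; the other
  direction is immediate, with \<open>mat 1\<close> as the second factor.\<close>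

lemma green_J_mult_left:
  assumes "P' ** P = mat 1"
  shows "green_J A (P ** A)"
  unfolding green_J_def green_J_le_def
  using assms by (metis matrix_mul_assoc matrix_mul_lid matrix_mul_rid)

lemma green_J_mult_right:
  assumes "P ** P' = mat 1"
  shows "green_J A (A ** P)"
  unfolding green_J_def green_J_le_def
  using assms by (metis matrix_mul_assoc matrix_mul_lid matrix_mul_rid)

text \<open>A diagonal unit is a product of two off-diagonal ones as soon as there is a second
  index. For \<open>n = 1\<close> there is none, and the only unit is \<open>mat 1\<close> itself,
  which is where \<open>one\<close> enters.\<close>

lemma mat_unit_in_mult_closed:
  fixes S :: "('a::semiring_1^'n^'n) set"
  assumes prod: "\<And>B C. B \<in> S \<Longrightarrow> C \<in> S \<Longrightarrow> B ** C \<in> S"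
    and one: "mat 1 \<in> S"
    and off: "\<And>i j. i \<noteq> j \<Longrightarrow> mat_unit i j \<in> S"
  shows "mat_unit i j \<in> S"
proof (cases "i = j")
  case True
  show ?thesis
  proof (cases "\<exists>k. k \<noteq> i")
    case True
    then obtain k where "k \<noteq> i" by blast
    then have "mat_unit i k ** mat_unit k i \<in> S"
      using off prod by metis
    then show ?thesis
      using \<open>i = j\<close> by (simp add: mat_unit_mult_mat_unit)
  next
    case False
    then have triv: "k = i" for k by blast
    have "(mat_unit i j :: 'a^'n^'n) $ r $ s = mat 1 $ r $ s" for r s
      using \<open>i = j\<close> triv[of r] triv[of s] by (simp add: mat_def)
    then have "(mat_unit i j :: 'a^'n^'n) = mat 1"
      by (simp add: vec_eq_iff)
    then show ?thesis using one by simp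
  qed
qed (use off in blast)

interpretation mat: vector_space mat_scale
  by (rule vector_space_mat_scale)

text \<open>\<open>V\<close> absorbs matrix units on both sides, so one nonzero entry of
  \<open>A\<close> puts all multiples of all matrix units into \<open>V\<close>, and these sum to
  any matrix.\<close>

lemma green_J_closed_subspace_eq_UNIV:
  fixes V :: "('a::field^'n^'n) set"
  assumes V: "mat.subspace V"
    and J: "\<And>A B. A \<in> V \<Longrightarrow> green_J A B \<Longrightarrow> B \<in> V"
    and A: "A \<in> V" "A \<noteq> 0"
  shows "V = UNIV"
proof -
  have left: "mat_unit i j ** B \<in> V" if "B \<in> V" for i j B
  proof -
    \<comment> \<open>The left multipliers of \<open>V\<close> contain \<open>mat 1\<close> and are
      closed under products by associativity, so only off-diagonal units need an argument.\<close>
    have "mat_unit i j \<in> {M. \<forall>B\<in>V. M ** B \<in> V}"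
    proof (rule mat_unit_in_mult_closed)
      fix i j :: 'n
      assume "i \<noteq> j"
      then have inv: "(mat 1 - mat_unit i j) ** (mat 1 + mat_unit i j) = (mat 1 :: 'a^'n^'n)"
        by (intro mat_1_minus_mult_mat_1_plus) (simp add: mat_unit_mult_mat_unit)
      have "mat_unit i j ** B \<in> V" if "B \<in> V" for B
      proof -
        \<comment> \<open>The transvection keeps \<open>B\<close> in its class, hence in
          \<open>V\<close>; subtracting \<open>B\<close> leaves the product with the unit
          alone.\<close>
        have "(mat 1 + mat_unit i j) ** B - B \<in> V"
          using mat.subspace_diff[OF V J[OF that green_J_mult_left[OF inv]] that] .
        then show ?thesis by (simp add: matrix_mult_add_distrib_right)
      qed
      then show "mat_unit i j \<in> {M. \<forall>B\<in>V. M ** B \<in> V}" by blast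
    qed (simp_all flip: matrix_mul_assoc)
    then show ?thesis using that by blast
  qed
  have right: "B ** mat_unit i j \<in> V" if "B \<in> V" for i j B
  proof -
    have "mat_unit i j \<in> {M. \<forall>B\<in>V. B ** M \<in> V}"
    proof (rule mat_unit_in_mult_closed)
      fix i j :: 'n
      assume "i \<noteq> j"
      \<comment> \<open>The factors are swapped compared with the left case: multiplication on the
        right needs a right inverse.\<close>
      then have inv: "(mat 1 + mat_unit i j) ** (mat 1 - mat_unit i j) = (mat 1 :: 'a^'n^'n)"
        by (intro mat_1_minus_mult_mat_1_plus) (simp add: mat_unit_mult_mat_unit)
      have "B ** mat_unit i j \<in> V" if "B \<in> V" for B
      proof -
        have "B ** (mat 1 + mat_unit i j) - B \<in> V"
          using mat.subspace_diff[OF V J[OF that green_J_mult_right[OF inv]] that] .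
        then show ?thesis by (simp add: matrix_add_ldistrib)
      qed
      then show "mat_unit i j \<in> {M. \<forall>B\<in>V. B ** M \<in> V}" by blast
    qed (simp_all add: matrix_mul_assoc)
    then show ?thesis using that by blast
  qed
  obtain p q where pq: "A $ p $ q \<noteq> 0"
    using A(2) by (auto simp: vec_eq_iff)
  have unit: "mat_scale c (mat_unit i j) \<in> V" for c i j
  proof -
    \<comment> \<open>The product on the right has \<open>A $ p $ q\<close> at position
      \<open>(i, j)\<close> and zeros elsewhere.\<close>
    have "mat_scale c (mat_unit i j) =
        mat_scale (c / A $ p $ q) (mat_unit i p ** A ** mat_unit q j)"
      using pq by (auto simp: vec_eq_iff mat_unit_mult_nth mult_mat_unit_nth)
    then show ?thesis
      using left right A(1) mat.subspace_scale[OF V] by metis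
  qed
  have "B \<in> V" for B
  proof -
    have "B = (\<Sum>i\<in>UNIV. \<Sum>j\<in>UNIV. mat_scale (B $ i $ j) (mat_unit i j))"
      (is "_ = ?S")
    proof -
      have "?S $ r $ s = B $ r $ s" for r s
      proof -
        have "?S $ r $ s =
            (\<Sum>i\<in>UNIV. \<Sum>j\<in>UNIV. B $ i $ j * (if r = i \<and> s = j then 1 else 0))"
          by simp
        \<comment> \<open>Nesting the two tests lets each sum collapse in turn to its single nonzero
          term.\<close>
        also have "\<dots> =
            (\<Sum>i\<in>UNIV. \<Sum>j\<in>UNIV. if j = s then if i = r then B $ i $ j else 0 else 0)"
          by (intro sum.cong) auto
        finally show ?thesis by simp
      qed
      then show ?thesis by (simp add: vec_eq_iff)
    qed
    also have "\<dots> \<in> V"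
      by (intro mat.subspace_sum[OF V] unit)
    finally show ?thesis .
  qed
  then show ?thesis by blast
qed

text \<open>Matrices are flattened to vectors indexed by pairs, where an injective linear
  endomorphism is surjective by finite dimension; \<open>f\<close> and \<open>g\<close> are the two
  inverse linear isomorphisms.\<close>

lemma inj_linear_mat_imp_surj:
  fixes T :: "'a::field^'n^'m \<Rightarrow> 'a^'n^'m"
  assumes T: "Vector_Spaces.linear mat_scale mat_scale T" and "inj T"
  shows "surj T"
proof -
  interpret T: Vector_Spaces.linear mat_scale mat_scale T by fact
  define f :: "'a^'n^'m \<Rightarrow> 'a^('m \<times> 'n)" where "f A = (\<chi> p. A $ fst p $ snd p)" for A
  define g :: "'a^('m \<times> 'n) \<Rightarrow> 'a^'n^'m" where "g v = (\<chi> i j. v $ (i, j))" for v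
  have fg: "f (g v) = v" and gf: "g (f A) = A" for v A
    by (simp_all add: f_def g_def vec_eq_iff)
  have f: "f (A + B) = f A + f B" "f (mat_scale c A) = c *s f A"
    and g: "g (v + w) = g v + g w" "g (c *s v) = mat_scale c (g v)" for A B v w c
    by (simp_all add: f_def g_def vec_eq_iff)
  have "Vector_Spaces.linear (*s) (*s) (\<lambda>v. f (T (g v)))"
    by unfold_locales (simp_all add: f g T.add T.scale)
  moreover have "inj (\<lambda>v. f (T (g v)))"
    using \<open>inj T\<close> by (intro injI) (metis fg gf injD)
  ultimately have surj: "surj (\<lambda>v. f (T (g v)))"
    by (rule vec.linear_inj_imp_surj)
  have "B \<in> range T" for B
  proof -
    obtain v where "f B = f (T (g v))"
      using surj by (rule surjE)
    then have "g (f B) = g (f (T (g v)))" by (rule arg_cong)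
    then show ?thesis by (simp add: gf)
  qed
  then show ?thesis by blast
qed

theorem theorem5p3:
  fixes T :: "'a::field^'n^'n \<Rightarrow> 'a^'n^'n"
  assumes "Vector_Spaces.linear mat_scale mat_scale T"
    and "preserves_green_J T"
  shows "T = (\<lambda>_. 0) \<or> bij T"
proof (cases "inj T")
  case True
  then show ?thesis
    using inj_linear_mat_imp_surj[OF assms(1)] by (simp add: bij_def)
next
  case False
  interpret T: Vector_Spaces.linear mat_scale mat_scale T by fact
  obtain A where A: "T A = 0" "A \<noteq> 0"
    using False T.inj_iff_eq_0 by blast
  have "{A. T A = 0} = UNIV"
  proof (rule green_J_closed_subspace_eq_UNIV)
    show "mat.subspace {A. T A = 0}"
      by (rule T.subspace_kernel)
    fix A B :: "'a^'n^'n"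
    assume "A \<in> {A. T A = 0}" "green_J A B"
    then have "green_J 0 (T B)"
      using assms(2) by (force simp: preserves_green_J_def)
    \<comment> \<open>Only \<open>0\<close> has the form \<open>X ** 0 ** Y\<close>, so the class of
      \<open>0\<close> is a singleton.\<close>
    then show "B \<in> {A. T A = 0}"
      by (auto simp: green_J_def green_J_le_def)
  qed (use A in auto)
  then show ?thesis by auto
qed

end
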